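(* Let $\mathbb{K}$ be a field of characteristic zero and let $f=\frac{b}{c\,d^\lambda}\in\mathbb{K}(x,y,z)$, where $\lambda$ is a positive integer, $b,d\in\mathbb{K}[x,y,z]$, $c\in\mathbb{K}[x,y]$, $d$ is irreducible, $b,c,d$ are primitive as polynomials in $y,z$ (over $\mathbb{K}[x]$), and $\deg_z(b)<\deg_z(d)$. Suppose there is no positive integer $m$ such that $\sigma_x^m(d)=\sigma_y^n\sigma_z^k(d)$ for some $n,k\in\mathbb{Z}$. Then $f$ has a telescoper if and only if $f$ is $(\sigma_y,\sigma_z)$-summable.
   Context: $\sigma_x,\sigma_y,\sigma_z$ are the shift automorphisms of $\mathbb{K}(x,y,z)$: $\sigma_x(f)=f(x+1,y,z)$, $\sigma_y(f)=f(x,y+1,z)$, $\sigma_z(f)=f(x,y,z+1)$. A rational function $g\in\mathbb{K}(x,y,z)$ is $(\sigma_y,\sigma_z)$-summable if $g=\sigma_y(u)-u+\sigma_z(v)-v$ for some $u,v\in\mathbb{K}(x,y,z)$. A telescoper for $f$ is a nonzero operator $L=\sum_i \ell_i S_x^i$ with $\ell_i\in\mathbb{K}(x)$ such that $L(f)=\sum_i\ell_i f(x+i,y,z)$ is $(\sigma_y,\sigma_z)$-summable. *)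

theory Defs
  imports "HOL-Computational_Algebra.Polynomial" "HOL-Computational_Algebra.Fraction_Field"
begin

text \<open>K[x,y,z] is represented as nested univariate polynomials 'a poly poly poly:
  the outermost variable is z, the middle one is y, the innermost one is x.
  K(x,y,z) is its fraction field.\<close>

type_synonym 'a mpoly3 = "'a poly poly poly"

definition shift_x :: "'a::comm_ring_1 \<Rightarrow> 'a mpoly3 \<Rightarrow> 'a mpoly3" where
  "shift_x a p = map_poly (map_poly (\<lambda>q. pcompose q [:a, 1:])) p"

definition shift_y :: "'a::comm_ring_1 \<Rightarrow> 'a mpoly3 \<Rightarrow> 'a mpoly3" where
  "shift_y a p = map_poly (\<lambda>q. pcompose q [:[:a:], 1:]) p"

definition shift_z :: "'a::comm_ring_1 \<Rightarrow> 'a mpoly3 \<Rightarrow> 'a mpoly3" where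
  "shift_z a p = pcompose p [:[:[:a:]:], 1:]"

text \<open>Extension of an (injective) ring homomorphism to fraction fields, via any representative.\<close>
definition frac_map :: "('a::idom \<Rightarrow> 'b::idom) \<Rightarrow> 'a fract \<Rightarrow> 'b fract" where
  "frac_map h q = (let r = (SOME r. snd r \<noteq> 0 \<and> q = Fract (fst r) (snd r))
                   in Fract (h (fst r)) (h (snd r)))"

definition sigma_x :: "'a::idom mpoly3 fract \<Rightarrow> 'a mpoly3 fract" where
  "sigma_x = frac_map (shift_x 1)"
definition sigma_y :: "'a::idom mpoly3 fract \<Rightarrow> 'a mpoly3 fract" where
  "sigma_y = frac_map (shift_y 1)"
definition sigma_z :: "'a::idom mpoly3 fract \<Rightarrow> 'a mpoly3 fract" where
  "sigma_z = frac_map (shift_z 1)"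

definition yz_summable :: "'a::idom mpoly3 fract \<Rightarrow> bool" where
  "yz_summable g \<longleftrightarrow> (\<exists>u v. g = sigma_y u - u + sigma_z v - v)"

definition embed_x :: "'a::idom poly fract \<Rightarrow> 'a mpoly3 fract" where
  "embed_x = frac_map (\<lambda>a. [:[:a:]:])"

definition has_telescoper :: "'a::idom mpoly3 fract \<Rightarrow> bool" where
  "has_telescoper f \<longleftrightarrow> (\<exists>(N::nat) (l :: nat \<Rightarrow> 'a poly fract).
      (\<exists>i\<le>N. l i \<noteq> 0) \<and> yz_summable (\<Sum>i\<le>N. embed_x (l i) * (sigma_x ^^ i) f))"

definition primitive_yz :: "'a::field mpoly3 \<Rightarrow> bool" where
  "primitive_yz p \<longleftrightarrow> (\<forall>g. (\<forall>i j. g dvd coeff (coeff p i) j) \<longrightarrow> is_unit g)"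

end

theory Submission
  imports Defs "Berlekamp_Zassenhaus.Unique_Factorization_Poly"
begin

text \<open>Suppose \<open>L(f) = \<Sum>\<^sub>i l\<^sub>i \<sigma>\<^sub>x\<^sup>i f\<close> is summable and \<open>l\<^sub>j \<noteq> 0\<close>. Let \<open>P\<close> be the orbit of
  \<open>\<sigma>\<^sub>x\<^sup>j d\<close> under \<open>\<sigma>\<^sub>y\<close> and \<open>\<sigma>\<^sub>z\<close>, a set of primes of \<open>K[x,y][z]\<close>. Partial fractions in \<open>z\<close> over
  \<open>K(x,y)\<close> split \<open>K(x,y,z)\<close> as the direct sum of the proper fractions whose denominators are products
  of primes in \<open>P\<close> (up to factors in \<open>K[x,y]\<close>) and the fractions whose denominators are prime to \<open>P\<close>.
  Both summands are stable under \<open>\<sigma>\<^sub>y\<close> and \<open>\<sigma>\<^sub>z\<close>, so the component of a summable function in the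
  first one is summable. By the hypothesis on \<open>d\<close>, that component of \<open>L(f)\<close> is
  \<open>l\<^sub>j \<sigma>\<^sub>x\<^sup>j f\<close>; dividing by \<open>l\<^sub>j\<close> and applying \<open>\<sigma>\<^sub>x\<^sup>-\<^sup>j\<close> shows that \<open>f\<close> is summable.\<close>

section \<open>Fraction field maps\<close>

text \<open>\<open>frac_map\<close> takes an arbitrary representative. Applying \<open>h\<close> to
  the cross-multiplied equality of two representatives removes this dependence, and injectivity
  keeps the denominators nonzero.\<close>

lemma frac_map_Fract:
  assumes "inj_idom_hom h" "b \<noteq> 0"
  shows "frac_map h (Fract a b) = Fract (h a) (h b)"
proof -
  interpret inj_idom_hom h by fact
  define r where "r = (SOME r. snd r \<noteq> 0 \<and> Fract a b = Fract (fst r) (snd r))"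
  have "snd r \<noteq> 0 \<and> Fract a b = Fract (fst r) (snd r)"
    unfolding r_def by (rule someI[of _ "(a, b)"]) (use assms in simp)
  then have r: "snd r \<noteq> 0" "a * snd r = fst r * b"
    using assms by (auto simp: eq_fract)
  from r(2) have "h a * h (snd r) = h (fst r) * h b"
    by (metis hom_mult)
  then show ?thesis
    using r(1) assms(2) by (simp add: frac_map_def Let_def r_def[symmetric] eq_fract)
qed

lemma field_hom_frac_map:
  assumes "inj_idom_hom h"
  shows "field_hom (frac_map h)"
proof -
  interpret inj_idom_hom h by fact
  note F = frac_map_Fract[OF assms]
  show ?thesis
  proof
    show "frac_map h 0 = 0" "frac_map h 1 = 1"
      by (simp_all add: Zero_fract_def One_fract_def F)
    fix x y
    show "frac_map h (x + y) = frac_map h x + frac_map h y"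
      by (cases x; cases y) (simp add: F hom_distribs)
    show "frac_map h (x * y) = frac_map h x * frac_map h y"
      by (cases x; cases y) (simp add: F hom_distribs)
  qed
qed

lemma frac_map_frac_map:
  assumes "inj_idom_hom g" "inj_idom_hom h"
  shows "frac_map g (frac_map h q) = frac_map (\<lambda>x. g (h x)) q"
proof -
  interpret g: inj_idom_hom g by fact
  interpret h: inj_idom_hom h by fact
  have gh: "inj_idom_hom (\<lambda>x. g (h x))"
    by unfold_locales (auto simp: g.hom_add h.hom_add g.hom_mult h.hom_mult)
  show ?thesis
    by (cases q) (simp add: frac_map_Fract[OF gh] frac_map_Fract[OF assms(1)] frac_map_Fract[OF assms(2)])
qed

section \<open>Partial fractions with respect to a set of primes\<close>

text \<open>The factor \<open>k\<close>, a power of the leading coefficient of \<open>g\<close>,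
  clears denominators, so that division over the fraction field of the coefficients takes place
  inside the polynomial ring.\<close>

lemma pseudo_division:
  assumes "g \<noteq> (0 :: 'r::idom poly)"
  obtains k w r where "k \<noteq> 0" "smult k f = g * w + r" "r = 0 \<or> degree r < degree g"
proof -
  obtain w r where "pseudo_divmod f g = (w, r)" by force
  from pseudo_divmod[OF assms this] show ?thesis
    using that[of "lead_coeff g ^ (Suc (degree f) - degree g)" w r] assms by simp
qed

text \<open>In the application the coefficient ring is K[x,y] and the variable is z. Positive degree
  keeps the primes apart from the nonzero constants, which act as units because they are invertible
  in K(x,y).\<close>

locale prime_poly_set =
  fixes P :: "'r::idom poly set"
  assumes prime: "p \<in> P \<Longrightarrow> prime_elem p"
    and degree_pos: "p \<in> P \<Longrightarrow> 0 < degree p"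
begin

inductive_set P_smooth :: "'r poly set" where
  const: "e \<noteq> 0 \<Longrightarrow> [:e:] \<in> P_smooth"
| mult: "p \<in> P \<Longrightarrow> s \<in> P_smooth \<Longrightarrow> p * s \<in> P_smooth"

definition P_free :: "'r poly set" where
  "P_free = {t. t \<noteq> 0 \<and> (\<forall>p\<in>P. \<not> p dvd t)}"

text \<open>The case \<open>r = 0\<close> is separate because 0 has degree 0, so that the strict
  inequality fails over a constant denominator.\<close>

definition P_part :: "'r poly fract set" where
  "P_part = {Fract r s | r s. s \<in> P_smooth \<and> (r = 0 \<or> degree r < degree s)}"

text \<open>This is the localization of the polynomial ring at the multiplicative set
  \<open>P_free\<close>. It contains all polynomials over the fraction field of the
  coefficients.\<close>

definition P_integral :: "'r poly fract set" where
  "P_integral = {Fract a t | a t. t \<in> P_free}"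

lemma P_partI: "s \<in> P_smooth \<Longrightarrow> r = 0 \<or> degree r < degree s \<Longrightarrow> Fract r s \<in> P_part"
  unfolding P_part_def by blast

lemma P_integralI: "t \<in> P_free \<Longrightarrow> Fract a t \<in> P_integral"
  unfolding P_integral_def by blast

lemma P_nonzero: "p \<in> P \<Longrightarrow> p \<noteq> 0"
  using degree_pos by fastforce

lemma P_smooth_nonzero: "s \<in> P_smooth \<Longrightarrow> s \<noteq> 0"
  by (induction rule: P_smooth.induct) (auto dest: P_nonzero)

lemma P_smooth_mult: "s \<in> P_smooth \<Longrightarrow> s' \<in> P_smooth \<Longrightarrow> s * s' \<in> P_smooth"
proof (induction rule: P_smooth.induct)
  case (const e)
  from const(2,1) show ?case
  proof (induction rule: P_smooth.induct)
    case (const e')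
    then show ?case using P_smooth.const[of "e * e'"] by (simp add: mult.commute)
  next
    case (mult p s)
    then show ?case using P_smooth.mult[of p "[:e:] * s"] by (simp add: mult.left_commute)
  qed
next
  case (mult p s)
  then show ?case using P_smooth.mult[of p "s * s'"] by (simp add: mult.assoc)
qed

lemma const_P_smooth: "degree t = 0 \<Longrightarrow> t \<noteq> 0 \<Longrightarrow> t \<in> P_smooth"
  by (auto elim!: degree_eq_zeroE intro: P_smooth.const)

lemma power_P_smooth: "p \<in> P \<Longrightarrow> p ^ n \<in> P_smooth"
  by (induction n) (auto intro: P_smooth.mult const_P_smooth)

lemma const_not_multiple: "p \<in> P \<Longrightarrow> degree t = 0 \<Longrightarrow> t \<noteq> 0 \<Longrightarrow> \<not> p dvd t"
  using degree_pos[of p] dvd_imp_degree_le[of p t] by auto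

lemma const_P_free: "degree t = 0 \<Longrightarrow> t \<noteq> 0 \<Longrightarrow> t \<in> P_free"
  by (auto simp: P_free_def const_not_multiple)

lemma P_free_mult: "t \<in> P_free \<Longrightarrow> t' \<in> P_free \<Longrightarrow> t * t' \<in> P_free"
  using prime prime_elem_dvd_multD by (fastforce simp: P_free_def)

lemma power_P_free: "t \<in> P_free \<Longrightarrow> t ^ n \<in> P_free"
  by (induction n) (auto intro: P_free_mult const_P_free)

text \<open>Splitting off one prime of \<open>P\<close> lowers the degree, so the process stops at a
  cofactor in \<open>P_free\<close>.\<close>

lemma P_smooth_P_free_factorization:
  assumes "q \<noteq> 0"
  obtains s t where "s \<in> P_smooth" "t \<in> P_free" "q = s * t"
proof -
  have "\<exists>s\<in>P_smooth. \<exists>t\<in>P_free. q = s * t"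
    using assms
  proof (induction "degree q" arbitrary: q rule: less_induct)
    case less
    show ?case
    proof (cases "q \<in> P_free")
      case True
      then show ?thesis using P_smooth.const[of 1] by force
    next
      case False
      then obtain p q' where p: "p \<in> P" "q = p * q'"
        using less.prems by (auto simp: P_free_def)
      with less.prems have q': "q' \<noteq> 0" by auto
      have "degree q = degree p + degree q'"
        using p q' P_nonzero by (simp add: degree_mult_eq)
      with degree_pos[OF p(1)] have "degree q' < degree q" by simp
      from less.hyps[OF this q'] obtain s t where "s \<in> P_smooth" "t \<in> P_free" "q' = s * t" by blast
      with p show ?thesis
        by (intro bexI[of _ "p * s"] bexI[of _ t]) (auto intro: P_smooth.mult simp: mult.assoc)
    qed
  qed
  then show ?thesis using that by blast
qed

text \<open>A nonzero element of least degree in the ideal generated by \<open>p\<close> and \<open>t\<close> divides both up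
  to constants; were it not constant itself, \<open>p\<close> would divide it and hence \<open>t\<close>.\<close>

lemma prime_bezout:
  assumes p: "p \<in> P" and t: "\<not> p dvd t"
  obtains e a b where "e \<noteq> 0" "[:e:] = a * p + b * t"
proof -
  define I where "I = {a * p + b * t | a b. True}"
  have I_comb: "x * f - y * g \<in> I" if "f \<in> I" "g \<in> I" for f g x y
  proof -
    from that obtain a b a' b' where "f = a * p + b * t" "g = a' * p + b' * t"
      by (auto simp: I_def)
    then have "x * f - y * g = (x * a - y * a') * p + (x * b - y * b') * t"
      by (simp add: algebra_simps)
    then show ?thesis unfolding I_def by blast
  qed
  have pI: "p \<in> I" unfolding I_def by (rule CollectI) (rule exI[of _ 1], rule exI[of _ 0], simp)
  have tI: "t \<in> I" unfolding I_def by (rule CollectI) (rule exI[of _ 0], rule exI[of _ 1], simp)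
  obtain g where g: "g \<in> I" "g \<noteq> 0" and least: "\<And>f. f \<in> I \<Longrightarrow> f \<noteq> 0 \<Longrightarrow> degree g \<le> degree f"
    using ex_has_least_nat[of "\<lambda>f. f \<in> I \<and> f \<noteq> 0" p degree] pI P_nonzero[OF p] by blast
  have dvd: "\<exists>k w. k \<noteq> 0 \<and> smult k f = g * w" if "f \<in> I" for f
  proof -
    obtain k w r where k: "k \<noteq> 0" "smult k f = g * w + r" "r = 0 \<or> degree r < degree g"
      using pseudo_division[OF g(2)] .
    from k(2) have "r = [:k:] * f - w * g" by (simp add: mult.commute)
    with I_comb[OF that g(1)] have "r \<in> I" by metis
    with least k(3) have "r = 0" by fastforce
    with k show ?thesis by auto
  qed
  have "degree g = 0"
  proof (rule ccontr)
    assume dg: "degree g \<noteq> 0"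
    obtain k w where k: "k \<noteq> 0" "smult k p = g * w" using dvd[OF pI] by blast
    \<comment> \<open>A factor \<open>p\<close> of \<open>w\<close> could be cancelled, leaving
      \<open>[:k:] = g * v\<close>, a nonzero constant with a nonconstant divisor.\<close>
    have "\<not> p dvd w"
    proof
      assume "p dvd w"
      then obtain v where "w = p * v" ..
      with k have "p * [:k:] = p * (g * v)" by (simp add: ac_simps)
      then have "[:k:] = g * v" using P_nonzero[OF p] by (simp only: mult_cancel_left) simp
      with k(1) dg have "v \<noteq> 0" "degree (g * v) = 0" by (auto, metis degree_pCons_0)
      with g(2) dg show False by (simp add: degree_mult_eq)
    qed
    moreover have "p dvd g * w" unfolding k(2)[symmetric] by (simp add: dvd_smult)
    ultimately have pg: "p dvd g" using prime_elem_dvd_multD[OF prime[OF p]] by metis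
    obtain k' w' where k': "k' \<noteq> 0" "smult k' t = g * w'" using dvd[OF tI] by blast
    with pg have "p dvd [:k':] * t" by simp
    with t have "p dvd [:k':]" using prime_elem_dvd_multD[OF prime[OF p]] by metis
    with const_not_multiple[OF p, of "[:k':]"] k'(1) show False by simp
  qed
  then obtain e where e: "g = [:e:]" using degree_eq_zeroE by blast
  with g show ?thesis using that unfolding I_def by auto
qed

text \<open>In the product of the identities for \<open>s\<close> and for a further prime
  \<open>p\<close>, every term except the one with \<open>p * s\<close> contains the factor
  \<open>t\<close>.\<close>

lemma P_smooth_bezout:
  assumes "s \<in> P_smooth" "t \<in> P_free"
  obtains e a b where "e \<noteq> 0" "[:e:] = a * s + b * t"
proof -
  have "\<exists>e a b. e \<noteq> 0 \<and> [:e:] = a * s + b * t"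
    using assms(1)
  proof (induction rule: P_smooth.induct)
    case (const e)
    then show ?case by (intro exI[of _ e] exI[of _ 1] exI[of _ 0]) simp
  next
    case (mult p s)
    then obtain e a b where 1: "e \<noteq> 0" "[:e:] = a * s + b * t" by blast
    obtain e' a' b' where 2: "e' \<noteq> 0" "[:e':] = a' * p + b' * t"
      using prime_bezout[OF mult(1)] assms(2) mult(1) unfolding P_free_def by blast
    have "[:e * e':] = [:e:] * [:e':]" by simp
    also have "\<dots> = (a * a') * (p * s) + (a * s * b' + b * a' * p + b * b' * t) * t"
      unfolding 1(2) 2(2) by (simp add: algebra_simps)
    finally show ?case using 1(1) 2(1) by (metis mult_eq_0_iff)
  qed
  then show ?thesis using that by blast
qed

text \<open>For \<open>q = s * t\<close> the Bezout identity gives p/q = p n/(e s) + p m/(e t).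
  Pseudo-division of \<open>p * n\<close> by \<open>s\<close> makes the first fraction proper, and
  the quotient goes to the second one.\<close>

lemma partial_fraction_decomposition:
  obtains a b where "a \<in> P_part" "b \<in> P_integral" "x = a + b"
proof (cases x)
  case (Fract p q)
  obtain s t where st: "s \<in> P_smooth" "t \<in> P_free" "q = s * t"
    using P_smooth_P_free_factorization[OF Fract(2)] .
  obtain e m n where e: "e \<noteq> 0" "[:e:] = m * s + n * t"
    using P_smooth_bezout[OF st(1,2)] .
  note s0 = P_smooth_nonzero[OF st(1)]
  have t0: "t \<noteq> 0" using st(2) by (simp add: P_free_def)
  obtain k w r where k: "k \<noteq> 0" "smult k (p * n) = s * w + r" "r = 0 \<or> degree r < degree s"
    using pseudo_division[OF s0] .
  define E K where "E = [:e:]" and "K = [:k:]"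
  have EK: "E \<noteq> 0" "K \<noteq> 0" "degree E = 0" "degree K = 0"
    using e(1) k(1) by (simp_all add: E_def K_def)
  have E: "E = m * s + n * t" and r: "K * (p * n) = s * w + r"
    using e(2) k(2) by (simp_all add: E_def K_def)
  \<comment> \<open>Here \<open>a\<close> is r/(k e s), and \<open>b\<close> is w/(k e) + p m/(e t)
    over a common denominator.\<close>
  define a where "a = Fract r (K * E * s)"
  define b where "b = Fract (w * (E * t) + p * m * (K * E)) (K * E * (E * t))"
  have "K * E * s \<in> P_smooth"
    using P_smooth_mult[OF P_smooth.const st(1), of "k * e"] k(1) e(1)
    by (simp add: E_def K_def mult.commute)
  moreover have "degree (K * E * s) = degree s"
    using EK s0 by (simp add: degree_mult_eq)
  ultimately have a: "a \<in> P_part"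
    unfolding a_def using k(3) by (intro P_partI) auto
  have "K * E * (E * t) \<in> P_free"
    by (intro P_free_mult const_P_free EK st)
  then have b: "b \<in> P_integral" unfolding b_def by (rule P_integralI)
  have "r * (K * E * (E * t)) + (w * (E * t) + p * m * (K * E)) * (K * E * s)
      = K * E * E * (t * (s * w + r) + p * m * K * s)"
    by (simp add: algebra_simps)
  also have "\<dots> = K * K * E * E * p * (m * s + n * t)"
    unfolding r[symmetric] by (simp add: algebra_simps)
  also have "\<dots> = K * K * E * E * p * E"
    unfolding E[symmetric] ..
  finally have "p * ((K * E * s) * (K * E * (E * t))) =
      (r * (K * E * (E * t)) + (w * (E * t) + p * m * (K * E)) * (K * E * s)) * (s * t)"
    by (simp add: ac_simps)
  then have "x = a + b"
    unfolding Fract(1) st(3) a_def b_def using EK s0 t0 by (simp add: eq_fract)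
  then show ?thesis using that[OF a b] by blast
qed

text \<open>The Bezout identity times \<open>r\<close> writes a constant multiple of
  \<open>r\<close> as a combination of \<open>s\<close> and \<open>r * t\<close>, both divisible by
  \<open>s\<close>.\<close>

lemma P_smooth_dvd_cancel:
  assumes "s \<in> P_smooth" "t \<in> P_free" "s dvd r * t"
  obtains k where "k \<noteq> 0" "s dvd smult k r"
proof -
  obtain e a b where e: "e \<noteq> 0" "[:e:] = a * s + b * t" using P_smooth_bezout[OF assms(1,2)] .
  have "smult e r = [:e:] * r" by simp
  also have "\<dots> = s * (a * r) + b * (r * t)" unfolding e(2) by (simp add: algebra_simps)
  finally have "s dvd smult e r" using assms(3) by simp
  with e(1) show ?thesis by (rule that)
qed

text \<open>This makes the decomposition unique. After cross-multiplication \<open>s\<close> divides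
  a constant multiple of \<open>r\<close>, which is impossible for a nonzero \<open>r\<close> of
  smaller degree.\<close>

lemma P_part_Int_P_integral:
  assumes "x \<in> P_part" "x \<in> P_integral"
  shows "x = 0"
proof -
  obtain r s where s: "x = Fract r s" "s \<in> P_smooth" "r = 0 \<or> degree r < degree s"
    using assms(1) by (auto simp: P_part_def)
  obtain a t where t: "x = Fract a t" "t \<in> P_free"
    using assms(2) by (auto simp: P_integral_def)
  have "r * t = a * s"
    using s t P_smooth_nonzero[OF s(2)] by (auto simp: P_free_def eq_fract)
  then have "s dvd r * t" by simp
  then obtain k where "k \<noteq> 0" "s dvd smult k r" using P_smooth_dvd_cancel[OF s(2) t(2)] by blast
  with s(3) have "r = 0" using dvd_imp_degree_le[of s "smult k r"] by force
  then show ?thesis using s by (simp add: fract_collapse)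
qed

lemma P_part_diff:
  assumes "x \<in> P_part" "y \<in> P_part"
  shows "x - y \<in> P_part"
proof -
  obtain r s where s: "x = Fract r s" "s \<in> P_smooth" "r = 0 \<or> degree r < degree s"
    using assms(1) by (auto simp: P_part_def)
  obtain r' s' where s': "y = Fract r' s'" "s' \<in> P_smooth" "r' = 0 \<or> degree r' < degree s'"
    using assms(2) by (auto simp: P_part_def)
  note nz = P_smooth_nonzero[OF s(2)] P_smooth_nonzero[OF s'(2)]
  have "x - y = Fract (r * s' - r' * s) (s * s')" using s s' nz by simp
  moreover have "r * s' - r' * s = 0 \<or> degree (r * s' - r' * s) < degree (s * s')"
  proof -
    have "r * s' = 0 \<or> degree (r * s') < degree (s * s')"
      using s(3) nz by (cases "r = 0") (simp_all add: degree_mult_eq)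
    moreover have "r' * s = 0 \<or> degree (r' * s) < degree (s * s')"
      using s'(3) nz by (cases "r' = 0") (simp_all add: degree_mult_eq)
    ultimately show ?thesis
      using degree_diff_less[of "r * s'" "degree (s * s')" "r' * s"]
      by (cases "r * s' = 0"; cases "r' * s = 0") (simp_all del: mult_eq_0_iff)
  qed
  ultimately show ?thesis using P_smooth_mult[OF s(2) s'(2)] by (simp only: P_partI)
qed

lemma P_integral_diff:
  assumes "x \<in> P_integral" "y \<in> P_integral"
  shows "x - y \<in> P_integral"
proof -
  obtain a t a' t' where t: "x = Fract a t" "t \<in> P_free" "y = Fract a' t'" "t' \<in> P_free"
    using assms by (auto simp: P_integral_def)
  then have "x - y = Fract (a * t' - a' * t) (t * t')" by (simp add: P_free_def)
  then show ?thesis using P_free_mult[OF t(2,4)] by (simp only: P_integralI)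
qed

lemma zero_P_part: "0 \<in> P_part"
  using P_partI[OF P_smooth.const[of 1], of 0] by (simp add: Zero_fract_def pCons_one)

lemma zero_P_integral: "0 \<in> P_integral"
  using P_integralI[OF const_P_free[of 1], of 0] by (simp add: Zero_fract_def)

lemma P_part_add: "x \<in> P_part \<Longrightarrow> y \<in> P_part \<Longrightarrow> x + y \<in> P_part"
  using P_part_diff[of x "0 - y"] P_part_diff[OF zero_P_part, of y] by simp

lemma P_integral_add: "x \<in> P_integral \<Longrightarrow> y \<in> P_integral \<Longrightarrow> x + y \<in> P_integral"
  using P_integral_diff[of x "0 - y"] P_integral_diff[OF zero_P_integral, of y] by simp

lemma P_integral_sum: "(\<And>i. i \<in> A \<Longrightarrow> f i \<in> P_integral) \<Longrightarrow> sum f A \<in> P_integral"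
  by (induction A rule: infinite_finite_induct) (auto intro: zero_P_integral P_integral_add)

end

section \<open>Stability of the two summands under automorphisms permuting \<open>P\<close>\<close>

locale prime_poly_set_automorphism = prime_poly_set P for P :: "'r::idom poly set" +
  fixes h h' :: "'r poly \<Rightarrow> 'r poly"
  assumes hom: "inj_idom_hom h" and hom': "inj_idom_hom h'"
    and inverse: "h' (h p) = p"
    and degree_hom: "degree (h p) = degree p"
    and P_hom: "p \<in> P \<Longrightarrow> h p \<in> P" and P_hom': "p \<in> P \<Longrightarrow> h' p \<in> P"
begin

interpretation h: inj_idom_hom h by (rule hom)
interpretation h': inj_idom_hom h' by (rule hom')

lemma P_smooth_hom: "s \<in> P_smooth \<Longrightarrow> h s \<in> P_smooth"
proof (induction rule: P_smooth.induct)
  case (const e)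
  have "degree (h [:e:]) = 0" by (simp add: degree_hom)
  then obtain e' where "h [:e:] = [:e':]" using degree_eq_zeroE by blast
  moreover from this const have "e' \<noteq> 0" by (metis h.hom_0_iff pCons_eq_0_iff)
  ultimately show ?case by (simp add: P_smooth.const)
next
  case (mult p s)
  then show ?case by (simp add: h.hom_mult P_smooth.mult P_hom)
qed

text \<open>If some \<open>p\<close> in \<open>P\<close> divides \<open>h t\<close>, then
  \<open>h' p\<close>, again in \<open>P\<close>, divides \<open>h' (h t) = t\<close>.\<close>

lemma P_free_hom: "t \<in> P_free \<Longrightarrow> h t \<in> P_free"
  unfolding P_free_def using P_hom' h'.hom_dvd[of _ "h t"] by (auto simp: inverse)

lemma P_part_hom: "x \<in> P_part \<Longrightarrow> frac_map h x \<in> P_part"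
proof -
  assume "x \<in> P_part"
  then obtain r s where s: "x = Fract r s" "s \<in> P_smooth" "r = 0 \<or> degree r < degree s"
    by (auto simp: P_part_def)
  then have "frac_map h x = Fract (h r) (h s)"
    by (simp add: frac_map_Fract[OF hom] P_smooth_nonzero)
  moreover have "h r = 0 \<or> degree (h r) < degree (h s)"
    using s(3) by (auto simp: degree_hom)
  ultimately show ?thesis using P_smooth_hom[OF s(2)] by (simp only: P_partI)
qed

lemma P_integral_hom: "x \<in> P_integral \<Longrightarrow> frac_map h x \<in> P_integral"
proof -
  assume "x \<in> P_integral"
  then obtain a t where t: "x = Fract a t" "t \<in> P_free" by (auto simp: P_integral_def)
  then have "frac_map h x = Fract (h a) (h t)"
    by (simp add: frac_map_Fract[OF hom] P_free_def)
  then show ?thesis using P_free_hom[OF t(2)] by (simp only: P_integralI)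
qed

end

text \<open>The \<open>P_part\<close> components of \<open>u\<close> and \<open>v\<close> serve as
  witnesses for \<open>x\<close>: by stability, the error \<open>x - z\<close> lies in both summands
  and therefore vanishes.\<close>

lemma P_part_of_summable:
  assumes "prime_poly_set_automorphism P g g'" "prime_poly_set_automorphism P h h'"
    and x: "x \<in> prime_poly_set.P_part P" and y: "y \<in> prime_poly_set.P_integral P"
    and xy: "x + y = frac_map g u - u + frac_map h v - v"
  shows "\<exists>u v. x = frac_map g u - u + frac_map h v - v"
proof -
  interpret g: prime_poly_set_automorphism P g g' by fact
  interpret h: prime_poly_set_automorphism P h h' by fact
  interpret G: field_hom "frac_map g" by (rule field_hom_frac_map[OF g.hom])
  interpret H: field_hom "frac_map h" by (rule field_hom_frac_map[OF h.hom])
  obtain u1 u2 where u: "u1 \<in> g.P_part" "u2 \<in> g.P_integral" "u = u1 + u2"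
    using g.partial_fraction_decomposition .
  obtain v1 v2 where v: "v1 \<in> g.P_part" "v2 \<in> g.P_integral" "v = v1 + v2"
    using g.partial_fraction_decomposition .
  define z where "z = frac_map g u1 - u1 + frac_map h v1 - v1"
  define w where "w = frac_map g u2 - u2 + frac_map h v2 - v2"
  have "z \<in> g.P_part" unfolding z_def
    by (intro g.P_part_add g.P_part_diff g.P_part_hom h.P_part_hom u v)
  then have 1: "x - z \<in> g.P_part" by (intro g.P_part_diff x)
  have "w \<in> g.P_integral" unfolding w_def
    by (intro g.P_integral_add g.P_integral_diff g.P_integral_hom h.P_integral_hom u v)
  then have 2: "w - y \<in> g.P_integral" by (intro g.P_integral_diff y)
  have "x - z = w - y" using xy unfolding z_def w_def u v by (simp add: G.hom_add H.hom_add algebra_simps)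
  with 1 2 have "x - z = 0" by (intro g.P_part_Int_P_integral) auto
  then have "x = frac_map g u1 - u1 + frac_map h v1 - v1" unfolding z_def by simp
  then show ?thesis by blast
qed

section \<open>Shifts and orbits\<close>

lemma inj_idom_hom_pcompose_linear: "inj_idom_hom (\<lambda>q. pcompose q [:a :: 'r::idom, 1:])"
  by unfold_locales (auto dest: pcompose_eq_0)

lemma inj_idom_hom_map_poly:
  assumes "inj_idom_hom h"
  shows "inj_idom_hom (map_poly h)"
proof -
  interpret h: inj_idom_hom h by fact
  interpret map_h: map_poly_inj_idom_hom h ..
  show ?thesis by unfold_locales
qed

lemma inj_idom_hom_shift_x: "inj_idom_hom (shift_x (a :: 'a::idom))"
  unfolding shift_x_def by (intro inj_idom_hom_map_poly inj_idom_hom_pcompose_linear)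

lemma inj_idom_hom_shift_y: "inj_idom_hom (shift_y (a :: 'a::idom))"
  unfolding shift_y_def by (intro inj_idom_hom_map_poly inj_idom_hom_pcompose_linear)

lemma inj_idom_hom_shift_z: "inj_idom_hom (shift_z (a :: 'a::idom))"
  unfolding shift_z_def by (rule inj_idom_hom_pcompose_linear)

interpretation shift_x: inj_idom_hom "shift_x (a :: 'a::idom)" for a
  by (rule inj_idom_hom_shift_x)
interpretation shift_y: inj_idom_hom "shift_y (a :: 'a::idom)" for a
  by (rule inj_idom_hom_shift_y)
interpretation shift_z: inj_idom_hom "shift_z (a :: 'a::idom)" for a
  by (rule inj_idom_hom_shift_z)

lemma pcompose_linear_linear:
  "pcompose (pcompose p [:b, 1:]) [:a, 1:] = pcompose p [:a + b :: 'r::idom, 1:]"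
  by (simp add: pcompose_assoc[symmetric] pcompose_pCons add.commute)

lemma shift_x_shift_x: "shift_x a (shift_x b p) = shift_x (a + b :: 'a::idom) p"
  by (simp add: shift_x_def map_poly_map_poly o_def pcompose_linear_linear del: pCons_one)

lemma shift_y_shift_y: "shift_y a (shift_y b p) = shift_y (a + b :: 'a::idom) p"
  by (simp add: shift_y_def map_poly_map_poly o_def pcompose_linear_linear del: pCons_one)

lemma shift_z_shift_z: "shift_z a (shift_z b p) = shift_z (a + b :: 'a::idom) p"
  by (simp add: shift_z_def pcompose_linear_linear del: pCons_one)

lemma shift_x_0 [simp]: "shift_x 0 p = p"
  by (simp add: shift_x_def map_poly_idI del: pCons_one)

lemma shift_y_0 [simp]: "shift_y 0 p = p"
  by (simp add: shift_y_def map_poly_idI del: pCons_one)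

lemma shift_z_0 [simp]: "shift_z 0 p = p"
  by (simp add: shift_z_def del: pCons_one)

text \<open>The substituted polynomial has coefficients fixed by \<open>h\<close>. This is the
  source of the commutation of shifts in different variables.\<close>

lemma map_poly_pcompose_linear:
  assumes "inj_idom_hom h" "h a = (a :: 'r::idom)"
  shows "map_poly h (pcompose p [:a, 1:]) = pcompose (map_poly h p) [:a, 1:]"
proof -
  interpret inj_idom_hom h by fact
  show ?thesis using assms(2) by (simp add: map_poly_pcompose)
qed

lemma shift_x_shift_y: "shift_x a (shift_y b p) = shift_y b (shift_x (a :: 'a::idom) p)"
  by (simp add: shift_x_def shift_y_def map_poly_map_poly o_def
      map_poly_pcompose_linear[OF inj_idom_hom_pcompose_linear] del: pCons_one)

lemma shift_x_shift_z: "shift_x a (shift_z b p) = shift_z b (shift_x (a :: 'a::idom) p)"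
  unfolding shift_x_def shift_z_def
  by (intro map_poly_pcompose_linear inj_idom_hom_map_poly inj_idom_hom_pcompose_linear)
    (simp add: poly_eq_iff coeff_map_poly coeff_pCons split: nat.split)

lemma shift_y_shift_z: "shift_y a (shift_z b p) = shift_z b (shift_y (a :: 'a::idom) p)"
  unfolding shift_y_def shift_z_def
  by (intro map_poly_pcompose_linear inj_idom_hom_pcompose_linear) simp

section \<open>Leading coefficients and irreducibility under shifts\<close>

lemma lead_coeff_map_poly_inj:
  assumes "inj_idom_hom h"
  shows "lead_coeff (map_poly h p) = h (lead_coeff p)" "degree (map_poly h p) = degree p"
proof -
  interpret inj_idom_hom h by fact
  show "lead_coeff (map_poly h p) = h (lead_coeff p)" "degree (map_poly h p) = degree p"
    by (simp_all add: coeff_map_poly)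
qed

lemma degree_shift [simp]:
  fixes a :: "'a::idom"
  shows "degree (shift_x a p) = degree p" "degree (shift_y a p) = degree p"
    "degree (shift_z a p) = degree p"
  by (simp_all add: shift_x_def shift_y_def shift_z_def lead_coeff_map_poly_inj
      inj_idom_hom_map_poly inj_idom_hom_pcompose_linear degree_pcompose del: pCons_one)

lemma lead_coeff_pcompose_linear: "lead_coeff (pcompose p [:a, 1:]) = lead_coeff (p :: 'r::idom poly)"
  using lead_coeff_comp[of "[:a, 1:]" p] by simp

abbreviation lex_lead_coeff :: "'a::idom mpoly3 \<Rightarrow> 'a" where
  "lex_lead_coeff p \<equiv> lead_coeff (lead_coeff (lead_coeff p))"

text \<open>A shift substitutes a monic linear polynomial at one level of nesting, which keeps the
  leading coefficient there. At the outer levels it acts on coefficients and commutes with taking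
  leading ones.\<close>

lemma lex_lead_coeff_shift:
  fixes a :: "'a::idom"
  shows "lex_lead_coeff (shift_x a p) = lex_lead_coeff p"
    "lex_lead_coeff (shift_y a p) = lex_lead_coeff p"
    "lex_lead_coeff (shift_z a p) = lex_lead_coeff p"
  unfolding shift_x_def shift_y_def shift_z_def
  by (simp_all only: lead_coeff_map_poly_inj(1) inj_idom_hom_map_poly inj_idom_hom_pcompose_linear
      lead_coeff_pcompose_linear)

text \<open>Shifts preserve the lexicographic leading coefficient, so shifts of \<open>d\<close> that are associated
  are equal.\<close>

lemma dvd_irreducible_imp_eq:
  fixes p q :: "'a::field mpoly3"
  assumes "irreducible p" "irreducible q" "p dvd q" "lex_lead_coeff p = lex_lead_coeff q"
  shows "p = q"
proof -
  obtain e where e: "q = p * e" using assms(3) ..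
  with assms(1,2) have "is_unit e" by (metis irreducible_def)
  then obtain k where k: "e = [:[:[:k:]:]:]" by (auto simp: is_unit_poly_iff elim!: degree_eq_zeroE)
  have "lex_lead_coeff q = lex_lead_coeff p * lex_lead_coeff e"
    unfolding e by (simp only: lead_coeff_mult)
  moreover have "lex_lead_coeff e = k" by (simp add: k)
  moreover have "lex_lead_coeff p \<noteq> 0" using assms(1) by auto
  ultimately have "k = 1" using assms(4) by simp
  with e k show ?thesis by (simp add: pCons_one)
qed

text \<open>A factorization of \<open>h p\<close> is pulled back by \<open>h'\<close>, and a unit
  among the factors is carried forward again by \<open>h\<close>.\<close>

lemma irreducible_automorphism:
  assumes "inj_idom_hom h" "inj_idom_hom h'" "\<And>x. h' (h x) = x" "\<And>x. h (h' x) = x"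
    and "irreducible p"
  shows "irreducible (h p)"
proof -
  interpret h: inj_idom_hom h by fact
  interpret h': inj_idom_hom h' by fact
  have unit: "x dvd 1" if "h' x dvd 1" for x
    using h.hom_dvd[OF that] by (simp add: assms(4))
  show ?thesis
  proof (rule irreducibleI)
    show "h p \<noteq> 0" using assms(5) by auto
    show "\<not> h p dvd 1"
      using h'.hom_dvd[of "h p" 1] assms(3,5) by (auto simp: irreducible_def)
    fix x y assume "h p = x * y"
    then have "p = h' x * h' y" by (metis assms(3) h'.hom_mult)
    with assms(5) have "h' x dvd 1 \<or> h' y dvd 1" by (rule irreducibleD)
    then show "x dvd 1 \<or> y dvd 1" using unit by blast
  qed
qed

lemma irreducible_shift:
  fixes a :: "'a::idom"
  assumes "irreducible p"
  shows "irreducible (shift_x a p)" "irreducible (shift_y a p)" "irreducible (shift_z a p)"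
  using assms
    irreducible_automorphism[OF inj_idom_hom_shift_x[of a] inj_idom_hom_shift_x[of "- a"]]
    irreducible_automorphism[OF inj_idom_hom_shift_y[of a] inj_idom_hom_shift_y[of "- a"]]
    irreducible_automorphism[OF inj_idom_hom_shift_z[of a] inj_idom_hom_shift_z[of "- a"]]
  by (simp_all add: shift_x_shift_x shift_y_shift_y shift_z_shift_z)

section \<open>Orbits under the y- and z-shifts\<close>

definition yz_orbit :: "'a::idom mpoly3 \<Rightarrow> 'a mpoly3 set" where
  "yz_orbit d = {shift_y (of_int n) (shift_z (of_int k) d) | n k. True}"

lemma yz_orbit_self: "d \<in> yz_orbit d"
  unfolding yz_orbit_def by (rule CollectI, rule exI[of _ 0], rule exI[of _ 0]) simp

lemma yz_orbit_shift:
  assumes "p \<in> yz_orbit d"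
  shows "shift_y (of_int m) p \<in> yz_orbit d" "shift_z (of_int m) p \<in> yz_orbit d"
proof -
  obtain n k where p: "p = shift_y (of_int n) (shift_z (of_int k) d)"
    using assms by (auto simp: yz_orbit_def)
  have "shift_y (of_int m) p = shift_y (of_int (m + n)) (shift_z (of_int k) d)"
    by (simp add: p shift_y_shift_y)
  then show "shift_y (of_int m) p \<in> yz_orbit d" unfolding yz_orbit_def by blast
  have "shift_z (of_int m) p = shift_y (of_int n) (shift_z (of_int (m + k)) d)"
    by (simp add: p shift_z_shift_z shift_y_shift_z[symmetric])
  then show "shift_z (of_int m) p \<in> yz_orbit d" unfolding yz_orbit_def by blast
qed

text \<open>Shifts keep irreducibility and the degree in z, and irreducible elements of the
  factorial ring K[x,y,z] are prime.\<close>

lemma prime_poly_set_yz_orbit: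
  fixes d :: "'a::field mpoly3"
  assumes "irreducible d" "0 < degree d"
  shows "prime_poly_set (yz_orbit d)"
  using assms by unfold_locales (auto simp: yz_orbit_def irreducible_shift)

lemma prime_poly_set_automorphism_yz_orbit:
  fixes d :: "'a::field mpoly3"
  assumes "irreducible d" "0 < degree d"
  shows "prime_poly_set_automorphism (yz_orbit d) (shift_y 1) (shift_y (- 1))"
    "prime_poly_set_automorphism (yz_orbit d) (shift_z 1) (shift_z (- 1))"
proof -
  interpret prime_poly_set "yz_orbit d" by (rule prime_poly_set_yz_orbit[OF assms])
  show "prime_poly_set_automorphism (yz_orbit d) (shift_y 1) (shift_y (- 1))"
    using yz_orbit_shift(1)[of _ d 1] yz_orbit_shift(1)[of _ d "- 1"]
    by unfold_locales
      (simp_all add: shift_y.hom_add shift_y.hom_mult shift_y_shift_y)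
  show "prime_poly_set_automorphism (yz_orbit d) (shift_z 1) (shift_z (- 1))"
    using yz_orbit_shift(2)[of _ d 1] yz_orbit_shift(2)[of _ d "- 1"]
    by unfold_locales
      (simp_all add: shift_z.hom_add shift_z.hom_mult shift_z_shift_z)
qed

section \<open>Shifts of rational functions\<close>

lemma funpow_sigma_x_Fract:
  assumes "q \<noteq> 0"
  shows "(sigma_x ^^ i) (Fract p q) = Fract (shift_x (of_nat i) p) (shift_x (of_nat i) q)"
  using assms
  by (induction i)
    (simp_all add: sigma_x_def frac_map_Fract[OF inj_idom_hom_shift_x] shift_x_shift_x)

lemma inj_idom_hom_const_const: "inj_idom_hom (\<lambda>a :: 'r::idom. [:[:a:]:])"
  by unfold_locales (simp_all add: pCons_one)

interpretation embed_x: field_hom "embed_x :: 'a::idom poly fract \<Rightarrow> _"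
  unfolding embed_x_def by (rule field_hom_frac_map[OF inj_idom_hom_const_const])
interpretation sigma_y: field_hom "sigma_y :: 'a::idom mpoly3 fract \<Rightarrow> _"
  unfolding sigma_y_def by (rule field_hom_frac_map[OF inj_idom_hom_shift_y])
interpretation sigma_z: field_hom "sigma_z :: 'a::idom mpoly3 fract \<Rightarrow> _"
  unfolding sigma_z_def by (rule field_hom_frac_map[OF inj_idom_hom_shift_z])

lemma embed_x_Fract: "m \<noteq> 0 \<Longrightarrow> embed_x (Fract n m) = Fract [:[:n:]:] [:[:m:]:]"
  unfolding embed_x_def by (rule frac_map_Fract[OF inj_idom_hom_const_const])

lemma shift_const_const: "shift_y a [:[:n:]:] = [:[:n:]:]" "shift_z a [:[:n:]:] = [:[:n:]:]"
  by (simp_all add: shift_y_def shift_z_def poly_eq_iff coeff_map_poly coeff_pCons split: nat.split)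

lemma sigma_embed_x: "sigma_y (embed_x l) = embed_x l" "sigma_z (embed_x l) = embed_x l"
proof -
  obtain n m where l: "l = Fract n m" "m \<noteq> 0" by (cases l)
  then have nz: "[:[:m:]:] \<noteq> 0" by simp
  show "sigma_y (embed_x l) = embed_x l" "sigma_z (embed_x l) = embed_x l"
    unfolding l(1) embed_x_Fract[OF l(2)] sigma_y_def sigma_z_def
      frac_map_Fract[OF inj_idom_hom_shift_y nz] frac_map_Fract[OF inj_idom_hom_shift_z nz]
      shift_const_const by (rule refl)+
qed

text \<open>Elements of K(x) are fixed by \<open>sigma_y\<close> and \<open>sigma_z\<close>, so both
  witnesses can be divided by \<open>embed_x l\<close>.\<close>

lemma yz_summable_embed_x_cancel:
  assumes "l \<noteq> 0" "yz_summable (embed_x l * g)"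
  shows "yz_summable g"
proof -
  define e where "e = embed_x l"
  have e: "e \<noteq> 0" "sigma_y e = e" "sigma_z e = e"
    using assms(1) by (simp_all add: e_def sigma_embed_x)
  obtain u v where uv: "e * g = sigma_y u - u + sigma_z v - v"
    using assms(2) unfolding yz_summable_def e_def by blast
  have "g = (e * g) / e" using e by simp
  also have "\<dots> = sigma_y (u / e) - u / e + sigma_z (v / e) - v / e"
    unfolding uv by (simp add: sigma_y.hom_div sigma_z.hom_div e diff_divide_distrib add_divide_distrib)
  finally show ?thesis unfolding yz_summable_def by blast
qed

text \<open>The x-shift commutes with \<open>sigma_y\<close> and \<open>sigma_z\<close> and thus
  transports witnesses. A negative \<open>a\<close> serves to undo a power of
  \<open>sigma_x\<close>.\<close>

lemma yz_summable_shift_x: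
  assumes "yz_summable g"
  shows "yz_summable (frac_map (shift_x a) g)"
proof -
  interpret X: field_hom "frac_map (shift_x a)"
    by (rule field_hom_frac_map[OF inj_idom_hom_shift_x])
  obtain u v where uv: "g = sigma_y u - u + sigma_z v - v"
    using assms unfolding yz_summable_def by blast
  have "frac_map (shift_x a) (sigma_y w) = sigma_y (frac_map (shift_x a) w)"
    "frac_map (shift_x a) (sigma_z w) = sigma_z (frac_map (shift_x a) w)" for w
    by (simp_all add: sigma_y_def sigma_z_def frac_map_frac_map inj_idom_hom_shift_x
        inj_idom_hom_shift_y inj_idom_hom_shift_z shift_x_shift_y shift_x_shift_z)
  then have "frac_map (shift_x a) g = sigma_y (frac_map (shift_x a) u) - frac_map (shift_x a) u
      + sigma_z (frac_map (shift_x a) v) - frac_map (shift_x a) v"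
    unfolding uv by (simp add: X.hom_add X.hom_minus)
  then show ?thesis unfolding yz_summable_def by blast
qed

text \<open>The hypothesis speaks of positive x-shifts only, so the relation is reduced to the
  positive difference of \<open>i\<close> and \<open>j\<close>. For \<open>i < j\<close> this also
  inverts the y- and z-shifts.\<close>

lemma shift_x_notin_yz_orbit:
  fixes d :: "'a::field_char_0 mpoly3"
  assumes no_shift: "\<not> (\<exists>m::nat. m > 0 \<and> (\<exists>n k :: int.
            shift_x (of_nat m) d = shift_y (of_int n) (shift_z (of_int k) d)))"
    and "i \<noteq> j"
  shows "shift_x (of_nat i) d \<notin> yz_orbit (shift_x (of_nat j) d)"
proof
  assume "shift_x (of_nat i) d \<in> yz_orbit (shift_x (of_nat j) d)"
  then obtain n k where eq: "shift_x (of_nat i) d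
      = shift_y (of_int n) (shift_z (of_int k) (shift_x (of_nat j) d))"
    by (auto simp: yz_orbit_def)
  show False
  proof (cases "j < i")
    case True
    have "shift_x (of_nat (i - j)) d = shift_x (- of_nat j) (shift_x (of_nat i) d)"
      using True by (simp add: shift_x_shift_x of_nat_diff)
    also have "\<dots> = shift_y (of_int n) (shift_z (of_int k) d)"
      by (simp add: eq shift_x_shift_y shift_x_shift_z shift_x_shift_x)
    finally show False using no_shift True by (metis zero_less_diff)
  next
    case False
    then have ij: "i < j" using assms(2) by simp
    \<comment> \<open>The right side is \<open>d\<close> shifted by \<open>j - i\<close> in x with
      cancelling y- and z-shifts inserted, arranged so that \<open>eq\<close> applies to its inner
      part.\<close>
    have "shift_x (of_nat (j - i)) d
        = shift_y (of_int (- n)) (shift_z (of_int (- k)) (shift_x (- of_nat i)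
          (shift_y (of_int n) (shift_z (of_int k) (shift_x (of_nat j) d)))))"
      using ij by (simp add: shift_x_shift_x shift_x_shift_y shift_x_shift_z shift_y_shift_y
          shift_z_shift_z shift_y_shift_z of_nat_diff)
    also have "\<dots> = shift_y (of_int (- n)) (shift_z (of_int (- k)) d)"
      unfolding eq[symmetric] by (simp add: shift_x_shift_x)
    finally show False using no_shift ij by (metis zero_less_diff)
  qed
qed

section \<open>Isolating one summand of a telescoper\<close>

theorem theorem6p1:
  fixes b c d :: "'a::field_char_0 mpoly3" and lam :: nat
  assumes "lam > 0"
    and "degree c = 0"
    and "irreducible d"
    and "primitive_yz b" and "primitive_yz c" and "primitive_yz d"
    and "degree b < degree d"
    and "\<not> (\<exists>m::nat. m > 0 \<and> (\<exists>n k :: int.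
            shift_x (of_nat m) d = shift_y (of_int n) (shift_z (of_int k) d)))"
  shows "has_telescoper (Fract b (c * d ^ lam)) \<longleftrightarrow> yz_summable (Fract b (c * d ^ lam))"
proof
  let ?f = "Fract b (c * d ^ lam)"
  assume "yz_summable ?f"
  \<comment> \<open>The identity operator, of order 0 with coefficient 1, is the telescoper.\<close>
  then have "yz_summable (\<Sum>i\<le>0. embed_x 1 * (sigma_x ^^ i) ?f)" by simp
  then show "has_telescoper ?f"
    unfolding has_telescoper_def by (intro exI[of _ 0] exI[of _ "\<lambda>_. 1"]) simp
next
  let ?f = "Fract b (c * d ^ lam)"
  assume "has_telescoper ?f"
  then obtain N j and l :: "nat \<Rightarrow> 'a poly fract" where j: "j \<le> N" "l j \<noteq> 0"
    and sum: "yz_summable (\<Sum>i\<le>N. embed_x (l i) * (sigma_x ^^ i) ?f)"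
    unfolding has_telescoper_def by blast
  define X where "X = (\<lambda>i::nat. shift_x (of_nat i) :: 'a mpoly3 \<Rightarrow> _)"
  define P where "P = yz_orbit (X j d)"
  have degX: "degree (X i p) = degree p" for i p by (simp add: X_def)
  have irr: "irreducible (X i d)" for i by (simp add: X_def irreducible_shift assms(3))
  have deg_pos: "0 < degree (X j d)" using assms(7) by (simp add: degX)
  interpret prime_poly_set P
    unfolding P_def by (rule prime_poly_set_yz_orbit[OF irr deg_pos])
  have c0: "c \<noteq> 0"
  proof
    assume "c = 0"
    \<comment> \<open>The coefficients of a zero \<open>c\<close> would have the nonunit 0 as a
      common divisor.\<close>
    with assms(5) show False unfolding primitive_yz_def by (auto dest: spec[of _ 0])
  qed
  have d0: "d \<noteq> 0" using assms(3) by auto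
  have den0: "c * d ^ lam \<noteq> 0" using c0 d0 by simp
  have X0: "X i p = 0 \<longleftrightarrow> p = 0" for i p by (simp add: X_def)
  \<comment> \<open>The coefficient \<open>l i\<close>, a quotient n/m, and the shifted
    \<open>c\<close> contribute only factors free of z, so the denominator depends on z only through
    the power of \<open>X i d\<close>.\<close>
  have summand: "\<exists>n m. m \<noteq> 0 \<and> embed_x (l i) * (sigma_x ^^ i) ?f
      = Fract ([:[:n:]:] * X i b) ([:[:m:]:] * X i c * X i d ^ lam)" for i
  proof -
    obtain n m where "l i = Fract n m" "m \<noteq> 0" by (cases "l i")
    then show ?thesis
      by (intro exI[of _ n] exI[of _ m])
        (simp add: embed_x_Fract funpow_sigma_x_Fract[OF den0] X_def shift_x.hom_mult
          shift_x.hom_power mult.assoc)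
  qed
  have integral: "embed_x (l i) * (sigma_x ^^ i) ?f \<in> P_integral" if "i \<noteq> j" for i
  proof -
    have "X i d \<in> P_free"
      unfolding P_free_def
    proof (intro CollectI conjI ballI notI)
      show False if "X i d = 0" using that d0 X0 by simp
      fix p assume p: "p \<in> P" "p dvd X i d"
      \<comment> \<open>All shifts of \<open>d\<close> have the same lexicographic leading
        coefficient, so an orbit element dividing \<open>X i d\<close> equals it, against the
        separation of the orbits.\<close>
      then have "irreducible p" "lex_lead_coeff p = lex_lead_coeff (X i d)"
        unfolding P_def yz_orbit_def X_def
        by (auto simp: irreducible_shift assms(3) lex_lead_coeff_shift simp del: degree_shift)
      then have "p = X i d" using p(2) irr by (intro dvd_irreducible_imp_eq)
      with p(1) show False
        using shift_x_notin_yz_orbit[OF assms(8) that] by (simp add: P_def X_def)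
    qed
    then have "[:[:m:]:] * X i c * X i d ^ lam \<in> P_free" if "m \<noteq> 0" for m
      by (intro P_free_mult power_P_free) (auto intro: const_P_free simp: degX X0 c0 assms(2) that)
    then show ?thesis using summand[of i] P_integralI by metis
  qed
  have part: "embed_x (l j) * (sigma_x ^^ j) ?f \<in> P_part"
  proof -
    have "X j d \<in> P" unfolding P_def by (rule yz_orbit_self)
    then have "[:[:m:]:] * X j c * X j d ^ lam \<in> P_smooth" if "m \<noteq> 0" for m
      by (intro P_smooth_mult power_P_smooth) (auto intro: const_P_smooth simp: degX X0 c0 assms(2) that)
    moreover have "degree ([:[:n:]:] * X j b) < degree ([:[:m:]:] * X j c * X j d ^ lam)"
      if "m \<noteq> 0" for n m
    proof -
      \<comment> \<open>An upper bound in place of an equality also covers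
        \<open>n = 0\<close>.\<close>
      have "degree ([:[:n:]:] * X j b) \<le> degree b"
        using degree_mult_le[of "[:[:n:]:]" "X j b"] by (simp add: degX)
      also have "\<dots> < degree d" by fact
      also have "\<dots> \<le> lam * degree d" using assms(1) by simp
      also have "\<dots> = degree ([:[:m:]:] * X j c * X j d ^ lam)"
        using that c0 d0 X0 by (simp add: degree_mult_eq degree_power_eq degX assms(2))
      finally show ?thesis .
    qed
    ultimately show ?thesis using summand[of j] P_partI by metis
  qed
  have split: "(\<Sum>i\<le>N. embed_x (l i) * (sigma_x ^^ i) ?f) = embed_x (l j) * (sigma_x ^^ j) ?f
      + (\<Sum>i\<in>{..N} - {j}. embed_x (l i) * (sigma_x ^^ i) ?f)"
    using j(1) by (intro sum.remove) auto
  obtain u v where uv: "embed_x (l j) * (sigma_x ^^ j) ?f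
      + (\<Sum>i\<in>{..N} - {j}. embed_x (l i) * (sigma_x ^^ i) ?f) = sigma_y u - u + sigma_z v - v"
    using sum unfolding split yz_summable_def by blast
  have "(\<Sum>i\<in>{..N} - {j}. embed_x (l i) * (sigma_x ^^ i) ?f) \<in> P_integral"
    using integral by (intro P_integral_sum) simp
  then have "yz_summable (embed_x (l j) * (sigma_x ^^ j) ?f)"
    using P_part_of_summable[OF prime_poly_set_automorphism_yz_orbit[OF irr deg_pos],
        folded P_def sigma_y_def sigma_z_def, OF part _ uv]
    unfolding yz_summable_def by blast
  then have "yz_summable ((sigma_x ^^ j) ?f)" by (rule yz_summable_embed_x_cancel[OF j(2)])
  then have "yz_summable (frac_map (shift_x (- of_nat j)) ((sigma_x ^^ j) ?f))"
    by (rule yz_summable_shift_x)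
  also have "frac_map (shift_x (- of_nat j)) ((sigma_x ^^ j) ?f) = ?f"
    using den0 by (simp add: funpow_sigma_x_Fract frac_map_Fract[OF inj_idom_hom_shift_x] shift_x_shift_x)
  finally show "yz_summable ?f" .
qed

end
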